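(* Let $0<\varepsilon<1/4$ and let $\theta\in C_0^\infty(\mathbb{R})$ be a nonnegative function with $\theta(x)>0$ for $x\in(-\pi-\varepsilon,\pi+\varepsilon)$ and $\operatorname{supp}\theta=[-\pi-\varepsilon,\pi+\varepsilon]$. Let $r\in\mathbb{N}$, $r\ge 2$, let $k_1,\dots,k_r\in\mathbb{Z}$, let $\phi_i$ be defined by $\widehat{\phi}_i(\xi)=\theta(\xi+k_i\pi)$, $\xi\in\mathbb{R}$, $i=1,\dots,r$, and let $\Phi=(\phi_1,\dots,\phi_r)^T$. 1) If $|k_2-k_1|=2$ and $|k_i-k_j|\ge 2$ for all different $i,j\le r$, then the rank of the matrix $[\widehat{\Phi}(\xi+2j\pi)]_{j\in\mathbb{Z}}$ is a constant function of $\xi\in\mathbb{R}$ and equals $r$. 2) If $|k_2-k_1|=2$ and there exist indices $1\le i_1,i_2\le r$ with $|k_{i_1}-k_{i_2}|=1$, then the rank of the matrix $[\widehat{\Phi}(\xi+2j\pi)]_{j\in\mathbb{Z}}$ is a non-constant function of $\xi\in\mathbb{R}$.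
   Context: $\widehat{\phi}(\xi)=\int_{\mathbb{R}}\phi(x)e^{-\mathrm{i}x\xi}\,dx$ denotes the Fourier transform. For $\Phi=(\phi_1,\dots,\phi_r)^T$ and $\xi\in\mathbb{R}$, $[\widehat{\Phi}(\xi+2j\pi)]_{j\in\mathbb{Z}}$ denotes the $r\times\infty$ matrix whose entry in row $i$ and column $j\in\mathbb{Z}$ is $\widehat{\phi}_i(\xi+2j\pi)$. *)

theory Defs
  imports "HOL-Analysis.Analysis" "HOL-Library.Function_Algebras"
begin

definition fourier :: "(real \<Rightarrow> complex) \<Rightarrow> real \<Rightarrow> complex" where
  "fourier f \<xi> = (LINT x|lebesgue. f x * exp (- (\<i> * of_real x * of_real \<xi>)))"

definition supp :: "(real \<Rightarrow> real) \<Rightarrow> real set" where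
  "supp f = closure (support_on UNIV f)"

definition compactly_supported_smooth :: "(real \<Rightarrow> real) \<Rightarrow> bool" where
  "compactly_supported_smooth f \<longleftrightarrow>
     (\<forall>n. (deriv ^^ n) f differentiable_on UNIV) \<and> compact (supp f)"

text \<open>
  The complex vector space of two-sided sequences. It is interpreted by hand, since the
  function type is not an instance of the class \<^class>\<open>real_vector\<close>.
\<close>

interpretation cseq: vector_space "\<lambda>(c::complex) (f::int \<Rightarrow> complex) j. c * f j"
  by unfold_locales (auto simp: fun_eq_iff algebra_simps)

text \<open>
  An $r \times \infty$ matrix is a function of a row index in $\{1,\dots,r\}$ and a column
  index in $\mathbb{Z}$. As for \<^const>\<open>rank\<close> on finite matrices, the rank is the dimension of
  the row space; it is spanned by finitely many vectors, so this dimension is always finite.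
\<close>

definition rank_inf :: "nat \<Rightarrow> (nat \<Rightarrow> int \<Rightarrow> complex) \<Rightarrow> nat" where
  "rank_inf r A = cseq.dim (cseq.span (A ` {1..r}))"

definition fourier_matrix :: "(nat \<Rightarrow> real \<Rightarrow> complex) \<Rightarrow> real \<Rightarrow> nat \<Rightarrow> int \<Rightarrow> complex" where
  "fourier_matrix \<Phi> \<xi> = (\<lambda>i j. fourier (\<Phi> i) (\<xi> + 2 * of_int j * pi))"

end

theory Submission
  imports Defs
begin

text \<open>
  Row \<open>i\<close> of the matrix at \<open>\<xi>\<close> has the entries \<open>\<theta>(\<xi> + (2 j + k\<^sub>i) \<pi>)\<close>. Since the support of \<open>\<theta>\<close> is
  longer than \<open>2 \<pi>\<close>, the row has a first nonzero entry, in column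
  \<open>\<lfloor>(c - k\<^sub>i) / 2\<rfloor> + 1\<close> with \<open>c\<close> depending only on \<open>\<xi>\<close>. If the \<open>k\<^sub>i\<close> are at least 2 apart, these
  columns are distinct, so the rows are in echelon form and the rank is \<open>r\<close>.

  For the second part let \<open>S = {-k\<^sub>1, \<dots>, -k\<^sub>r}\<close>, let \<open>s\<close> be maximal with \<open>s, s + 1 \<in> S\<close>, and
  normalise to \<open>d\<^sub>i = -k\<^sub>i - s\<close>. At \<open>\<xi> = s \<pi> + \<pi> / 2\<close> every row is a multiple of the
  unit vector of column \<open>\<lfloor>d\<^sub>i / 2\<rfloor>\<close>, so the rank is at most the number of these columns. At
  \<open>\<xi> = s \<pi>\<close> the same columns are the leading ones, but the rows with odd \<open>d\<^sub>i = 2 m + 1\<close> are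
  supported on the two columns \<open>m\<close> and \<open>m + 1\<close>. Let \<open>1, 3, \<dots>, 2 p - 1\<close> be the run of odd
  \<open>d\<^sub>i\<close> starting at 1. Since \<open>0\<close> is also among the \<open>d\<^sub>i\<close>, the row space contains the unit
  vectors of the columns \<open>0, \<dots>, p\<close>, and by maximality of \<open>s\<close> neither \<open>2 p\<close> nor \<open>2 p + 1\<close> is among
  the \<open>d\<^sub>i\<close>, so column \<open>p\<close> raises the rank.
\<close>

section \<open>Leading columns and rank bounds for two-sided sequences\<close>

definition unit_seq :: "int \<Rightarrow> int \<Rightarrow> complex" where
  "unit_seq p = (\<lambda>j. if j = p then 1 else 0)"

lemma span_vanishing:
  assumes "v \<in> cseq.span V" "\<And>w. w \<in> V \<Longrightarrow> w j = 0"
  shows "v j = 0"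
  using assms(1)
proof (induction rule: cseq.span_induct)
  case base
  show ?case by (rule cseq.subspaceI) auto
qed (use assms(2) in auto)

text \<open>The indices are added in decreasing order. All vectors already present vanish in column
  \<open>b\<close>, hence so does their span, whereas \<open>v b\<close> does not.\<close>

lemma echelon_independent:
  assumes "finite J" "\<And>j. j \<in> J \<Longrightarrow> v j j \<noteq> 0" "\<And>i j. j \<in> J \<Longrightarrow> i < j \<Longrightarrow> v j i = 0"
  shows "\<not> cseq.dependent (v ` J) \<and> card (v ` J) = card J"
  using assms
proof (induction rule: finite_linorder_min_induct)
  case empty
  show ?case by (simp add: cseq.independent_empty)
next
  case (insert b A)
  have IH: "\<not> cseq.dependent (v ` A)" "card (v ` A) = card A"
    using insert by auto
  have "v b \<notin> cseq.span (v ` A)"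
    using span_vanishing[of "v b" "v ` A" b] insert by auto
  moreover from this have "v b \<notin> v ` A"
    using cseq.span_superset by blast
  ultimately show ?case
    using IH insert by (auto simp: cseq.independent_insert card_insert_if)
qed

text \<open>Echelon vectors in the span are independent, so a basis has at least as many elements.
  Allowing any vector of the span, not just the generators, makes room for combinations of
  rows.\<close>

lemma card_leading_le_dim:
  assumes "finite V" "finite J"
    and lead: "\<And>j. j \<in> J \<Longrightarrow> \<exists>v\<in>cseq.span V. v j \<noteq> 0 \<and> (\<forall>i<j. v i = 0)"
  shows "card J \<le> cseq.dim (cseq.span V)"
proof -
  obtain v where v: "\<And>j. j \<in> J \<Longrightarrow> v j \<in> cseq.span V \<and> v j j \<noteq> 0 \<and> (\<forall>i<j. v j i = 0)"
    using lead by metis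
  obtain B where B: "B \<subseteq> V" "\<not> cseq.dependent B" "V \<subseteq> cseq.span B"
    using cseq.maximal_independent_subset by blast
  have span: "cseq.span B = cseq.span V"
    using B by (metis cseq.span_mono cseq.span_minimal cseq.subspace_span subset_antisym)
  have "card B = cseq.dim (cseq.span V)"
    using cseq.dim_eq_card[of B "cseq.span V"] B(2) span by (simp add: cseq.span_span)
  moreover have "\<not> cseq.dependent (v ` J)" "card (v ` J) = card J"
    using echelon_independent[of J v] v assms(2) by auto
  moreover have "v ` J \<subseteq> cseq.span B" using v span by auto
  ultimately show ?thesis
    using cseq.independent_span_bound[of B "v ` J"] B(1) finite_subset[OF _ assms(1)] by auto
qed

lemma card_leading_le_rank_inf:
  assumes "finite J"
    and "\<And>j. j \<in> J \<Longrightarrow> \<exists>v\<in>cseq.span (A ` {1..r}). v j \<noteq> 0 \<and> (\<forall>i<j. v i = 0)"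
  shows "card J \<le> rank_inf r A"
  unfolding rank_inf_def using assms by (intro card_leading_le_dim) auto

lemma rank_inf_le_card:
  assumes "finite W" "\<And>i. i \<in> {1..r} \<Longrightarrow> A i \<in> cseq.span W"
  shows "rank_inf r A \<le> card W"
  unfolding rank_inf_def
  using assms by (intro cseq.dim_le_card cseq.span_minimal) auto

lemma rank_inf_le: "rank_inf r A \<le> r"
proof -
  have "rank_inf r A \<le> card (A ` {1..r})"
    by (intro rank_inf_le_card) (auto intro: cseq.span_base)
  also have "\<dots> \<le> r"
    using card_image_le[of "{1..r}" A] by simp
  finally show ?thesis .
qed

text \<open>The endpoints are the point here: the nonvanishing set of a continuous function is open,
  so it lies in the interior of the support.\<close>

lemma eq_zero_outside_supp_interval:
  fixes f :: "real \<Rightarrow> real"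
  assumes "compactly_supported_smooth f" "supp f = {a..b}" "x \<le> a \<or> b \<le> x"
  shows "f x = 0"
proof -
  have "(deriv ^^ 0) f differentiable_on UNIV"
    using assms(1) unfolding compactly_supported_smooth_def by blast
  then have "continuous_on UNIV f"
    by (simp add: differentiable_imp_continuous_on)
  then have "open {x. f x \<noteq> 0}"
    by (intro open_Collect_neq) auto
  moreover have "{x. f x \<noteq> 0} \<subseteq> {a..b}"
    using assms(2) closure_subset[of "support_on UNIV f"]
    by (auto simp: supp_def support_on_def)
  ultimately have "{x. f x \<noteq> 0} \<subseteq> {a<..<b}"
    using interior_maximal by (metis interior_atLeastAtMost_real)
  then show ?thesis using assms(3) by force
qed

section \<open>Ranks of matrices whose rows sample a bump function\<close>

locale bump_rows =
  fixes \<epsilon> :: real and \<theta> :: "real \<Rightarrow> real" and r :: nat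
    and k :: "nat \<Rightarrow> int" and M :: "real \<Rightarrow> nat \<Rightarrow> int \<Rightarrow> complex"
  assumes eps: "0 < \<epsilon>" "\<epsilon> < 1/4"
    and pos: "\<And>x. - pi - \<epsilon> < x \<Longrightarrow> x < pi + \<epsilon> \<Longrightarrow> 0 < \<theta> x"
    and zero: "\<And>x. x \<le> - pi - \<epsilon> \<or> pi + \<epsilon> \<le> x \<Longrightarrow> \<theta> x = 0"
    and entry: "\<And>i \<xi> j. i \<in> {1..r} \<Longrightarrow>
      M \<xi> i j = of_real (\<theta> (\<xi> + 2 * of_int j * pi + of_int (k i) * pi))"
begin

lemma rank_eq_if_gaps:
  assumes gap: "\<And>i j. i \<in> {1..r} \<Longrightarrow> j \<in> {1..r} \<Longrightarrow> i \<noteq> j \<Longrightarrow> 2 \<le> \<bar>k i - k j\<bar>"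
  shows "rank_inf r (M \<xi>) = r"
proof -
  define c where "c = (- pi - \<epsilon> - \<xi>) / pi"
  \<comment> \<open>\<open>y i\<close> is the real column position at which the argument of
    \<open>\<theta>\<close> meets the left endpoint of the support. Since \<open>\<theta>\<close>
    vanishes there, the leading column is the least integer strictly above \<open>y i\<close>: floor
    plus one, not the ceiling.\<close>
  define y where "y i = (c - of_int (k i)) / 2" for i
  define l where "l i = \<lfloor>y i\<rfloor> + 1" for i
  have arg: "\<xi> + 2 * of_int j * pi + of_int (k i) * pi = - pi - \<epsilon> + 2 * pi * (of_int j - y i)" for i j
    by (simp add: y_def c_def field_simps)
  have inj: "inj_on l {1..r}"
  proof (rule inj_onI, rule ccontr)
    fix i j assume ij: "i \<in> {1..r}" "j \<in> {1..r}" "l i = l j" "i \<noteq> j"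
    have "2 * y i - 2 * y j = of_int (k j) - of_int (k i)"
      by (simp add: y_def field_simps)
    moreover have "(2::real) \<le> of_int (k i) - of_int (k j) \<or> (2::real) \<le> of_int (k j) - of_int (k i)"
      using gap[OF ij(1,2,4)] by linarith
    ultimately have "y j + 1 \<le> y i \<or> y i + 1 \<le> y j" by argo
    then show False using ij(3) by (simp add: l_def) linarith
  qed
  have "card (l ` {1..r}) \<le> rank_inf r (M \<xi>)"
  proof (rule card_leading_le_rank_inf)
    fix j assume "j \<in> l ` {1..r}"
    then obtain i where i: "i \<in> {1..r}" "j = l i" by auto
    have "0 < of_int j - y i" "of_int j - y i \<le> 1"
      unfolding i l_def by linarith+
    \<comment> \<open>The distance from the left endpoint is at most 2 pi, less than the support
      length 2 pi + 2 \<open>\<epsilon>\<close>.\<close>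
    then have "0 < 2 * pi * (of_int j - y i)" "2 * pi * (of_int j - y i) \<le> 2 * pi * 1"
      by (auto intro: mult_left_mono)
    then have "0 < \<theta> (- pi - \<epsilon> + 2 * pi * (of_int j - y i))"
      using eps by (intro pos) linarith+
    then have "M \<xi> i j \<noteq> 0"
      using entry[OF i(1)] arg by simp
    moreover have "M \<xi> i h = 0" if "h < j" for h
    proof -
      have "of_int h - y i \<le> 0"
        using that unfolding i l_def by linarith
      then have "2 * pi * (of_int h - y i) \<le> 0"
        by (intro mult_nonneg_nonpos) auto
      then show ?thesis
        using entry[OF i(1)] arg zero by simp
    qed
    ultimately show "\<exists>v\<in>cseq.span (M \<xi> ` {1..r}). v j \<noteq> 0 \<and> (\<forall>i<j. v i = 0)"
      using i(1) by (blast intro: cseq.span_base)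
  qed simp
  then show ?thesis
    using rank_inf_le[of r "M \<xi>"] card_image[OF inj] by simp
qed

text \<open>As \<open>\<epsilon>\<close> < 1/4 < pi/2, the point 3 pi/2 is already outside the
  support. The bound 3/2 serves both the integer and the half-integer multiples of pi met
  below.\<close>

lemma theta_pi_zero:
  assumes "3/2 \<le> \<bar>x\<bar>"
  shows "\<theta> (x * pi) = 0"
proof -
  have "3/2 * pi \<le> \<bar>x\<bar> * pi"
    using assms by (intro mult_right_mono) auto
  moreover have "\<bar>x * pi\<bar> = \<bar>x\<bar> * pi" by (simp add: abs_mult)
  ultimately have "pi + \<epsilon> \<le> \<bar>x * pi\<bar>"
    using eps pi_gt3 by linarith
  then show ?thesis by (intro zero) linarith
qed

lemma theta_pi_pos:
  assumes "\<bar>x\<bar> \<le> 1"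
  shows "0 < \<theta> (x * pi)"
proof -
  have "\<bar>x * pi\<bar> \<le> pi"
    using mult_right_mono[OF assms, of pi] by (simp add: abs_mult)
  then show ?thesis using eps by (intro pos) linarith+
qed

lemma rank_less_if_adjacent:
  assumes a: "a \<in> {1..r}" and b: "b \<in> {1..r}" and ab: "k a - k b = 1"
  shows "\<exists>\<xi> \<xi>'. rank_inf r (M \<xi>) < rank_inf r (M \<xi>')"
proof -
  define S where "S = (\<lambda>i. - k i) ` {1..r}"
  define P where "P = {s \<in> S. s + 1 \<in> S}"
  have finS: "finite S" by (simp add: S_def)
  then have finP: "finite P" by (simp add: P_def)
  have "- k b = - k a + 1" using ab by simp
  then have "- k a \<in> P"
    using a b unfolding P_def S_def by (metis (mono_tags, lifting) imageI mem_Collect_eq)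
  then have neP: "P \<noteq> {}" by auto
  define s where "s = Max P"
  have sP: "s \<in> P" using finP neP by (simp add: s_def)
  have smax: "t \<le> s" if "t \<in> S" "t + 1 \<in> S" for t
    using that finP by (simp add: s_def P_def)
  define d where "d i = - k i - s" for i
  have "\<exists>p::nat. s + 2 * int p + 1 \<notin> S"
  proof (rule ccontr)
    assume "\<not> ?thesis"
    then have "(\<lambda>p. s + 2 * int p + 1) ` UNIV \<subseteq> S" by auto
    then have "finite (range (\<lambda>p. s + 2 * int p + 1))"
      using finS finite_subset by blast
    then have "finite (UNIV :: nat set)"
      by (rule finite_imageD) (auto simp: inj_on_def)
    then show False by simp
  qed
  define p where "p = (LEAST p::nat. s + 2 * int p + 1 \<notin> S)"
  have p: "s + 2 * int p + 1 \<notin> S"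
    unfolding p_def by (rule LeastI_ex) fact
  have below: "s + 2 * int q + 1 \<in> S" if "q < p" for q
    using not_less_Least that unfolding p_def by blast
  have "p \<noteq> 0"
    using p sP by (auto simp: P_def intro!: gr0I)
  then have "s + 2 * int (p - 1) + 1 \<in> S" "int (p - 1) = int p - 1"
    using below[of "p - 1"] by linarith+
  \<comment> \<open>The odd run ends at s + 2p - 1 > s; if s + 2p were in \<open>S\<close> too, this
    would be an adjacent pair above the maximal one.\<close>
  then have p': "s + 2 * int p \<notin> S"
    using smax[of "s + 2 * int (p - 1) + 1"] \<open>p \<noteq> 0\<close> by auto
  define T where "T = (\<lambda>i. d i div 2) ` {1..r}"
  have finT: "finite T" by (simp add: T_def)
  have pT: "int p \<notin> T"
  proof
    assume "int p \<in> T"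
    then obtain i where i: "i \<in> {1..r}" "int p = d i div 2" by (auto simp: T_def)
    then have "- k i = s + 2 * int p \<or> - k i = s + 2 * int p + 1"
      unfolding d_def by presburger
    moreover have "- k i \<in> S" using i(1) by (simp add: S_def)
    ultimately show False using p p' by auto
  qed
  define \<xi> where "\<xi> = of_int s * pi"
  define \<xi>' where "\<xi>' = of_int s * pi + pi / 2"
  have ent: "M \<xi> i j = of_real (\<theta> (of_int (2 * j - d i) * pi))" if "i \<in> {1..r}" for i j
    unfolding entry[OF that] \<xi>_def d_def by (simp add: algebra_simps)
  have ent': "M \<xi>' i j = of_real (\<theta> ((of_int (2 * j - d i) + 1/2) * pi))" if "i \<in> {1..r}" for i j
    unfolding entry[OF that] \<xi>'_def d_def by (simp add: algebra_simps)
  have "rank_inf r (M \<xi>') \<le> card (unit_seq ` T)"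
  proof (rule rank_inf_le_card)
    fix i assume i: "i \<in> {1..r}"
    have "M \<xi>' i = (\<lambda>j. M \<xi>' i (d i div 2) * unit_seq (d i div 2) j)"
    proof
      fix j
      show "M \<xi>' i j = M \<xi>' i (d i div 2) * unit_seq (d i div 2) j"
      proof (cases "j = d i div 2")
        case False
        \<comment> \<open>For j = \<open>d i div 2\<close> the sample point is pi/2 or -pi/2; every
          other column is at least 3 pi/2 from the origin.\<close>
        then have "2 * j - d i \<le> -2 \<or> 1 \<le> 2 * j - d i" by presburger
        then have "3/2 \<le> \<bar>real_of_int (2 * j - d i) + 1/2\<bar>" by linarith
        then show ?thesis
          using False ent'[OF i, of j] theta_pi_zero by (simp add: unit_seq_def)
      qed (simp add: unit_seq_def)
    qed
    moreover have "unit_seq (d i div 2) \<in> cseq.span (unit_seq ` T)"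
      using i by (auto simp: T_def intro: cseq.span_base)
    ultimately show "M \<xi>' i \<in> cseq.span (unit_seq ` T)"
      using cseq.span_scale by metis
  qed (use finT in simp)
  also have "\<dots> \<le> card T" by (rule card_image_le[OF finT])
  also have "\<dots> < card (insert (int p) T)" using finT pT by simp
  also have "\<dots> \<le> rank_inf r (M \<xi>)"
  proof (rule card_leading_le_rank_inf)
    have row: "M \<xi> i \<in> cseq.span (M \<xi> ` {1..r})" if "i \<in> {1..r}" for i
      using that by (auto intro: cseq.span_base)
    \<comment> \<open>Induction along the odd run: the row with \<open>d i = 0\<close> yields the
      unit vector of column 0, and the row with \<open>d i = 2 * int q + 1\<close> then trades
      column q for column q + 1.\<close>
    have unit: "unit_seq (int q) \<in> cseq.span (M \<xi> ` {1..r})" if "q \<le> p" for q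
      using that
    proof (induction q)
      case 0
      obtain i where i: "i \<in> {1..r}" "d i = 0"
        using sP by (auto simp: P_def S_def d_def)
      have "M \<xi> i j = of_real (\<theta> 0) * unit_seq 0 j" for j
      proof (cases "j = 0")
        case False
        then have "3/2 \<le> \<bar>real_of_int (2 * j)\<bar>" by linarith
        then show ?thesis
          using False ent[OF i(1), of j] i(2) theta_pi_zero by (simp add: unit_seq_def)
      qed (use ent[OF i(1)] i(2) in \<open>simp add: unit_seq_def\<close>)
      then have "unit_seq 0 = (\<lambda>j. inverse (of_real (\<theta> 0)) * M \<xi> i j)"
        using theta_pi_pos[of 0] by auto
      then show ?case
        using cseq.span_scale[OF row[OF i(1)]] by simp
    next
      case (Suc q)
      obtain i where i: "i \<in> {1..r}" "d i = 2 * int q + 1"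
        using below[of q] Suc by (auto simp: S_def d_def)
      define x where "x = complex_of_real (\<theta> (- pi))"
      define y where "y = complex_of_real (\<theta> pi)"
      have y: "y \<noteq> 0" using theta_pi_pos[of 1] by (simp add: y_def)
      have "M \<xi> i j = x * unit_seq (int q) j + y * unit_seq (int (Suc q)) j" for j
      proof (cases "j = int q \<or> j = int q + 1")
        case False
        then have "2 * j - d i \<le> -2 \<or> 2 \<le> 2 * j - d i" unfolding i(2) by presburger
        then have "3/2 \<le> \<bar>real_of_int (2 * j - d i)\<bar>" by linarith
        then show ?thesis
          using False ent[OF i(1), of j] theta_pi_zero by (simp add: unit_seq_def)
      qed (use ent[OF i(1)] i(2) in \<open>auto simp: unit_seq_def x_def y_def\<close>)
      then have "unit_seq (int (Suc q)) =
          (\<lambda>j. inverse y * M \<xi> i j) - (\<lambda>j. (x / y) * unit_seq (int q) j)"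
        using y by (auto simp: fun_eq_iff field_simps)
      moreover have "unit_seq (int q) \<in> cseq.span (M \<xi> ` {1..r})"
        using Suc by simp
      ultimately show ?case
        using cseq.span_diff[OF cseq.span_scale[OF row[OF i(1)]] cseq.span_scale] by metis
    qed
    fix j assume "j \<in> insert (int p) T"
    then consider "j = int p" | i where "i \<in> {1..r}" "j = d i div 2"
      by (auto simp: T_def)
    then show "\<exists>v\<in>cseq.span (M \<xi> ` {1..r}). v j \<noteq> 0 \<and> (\<forall>i<j. v i = 0)"
    proof cases
      case 1
      then show ?thesis
        using unit[of p] by (intro bexI[of _ "unit_seq (int p)"]) (auto simp: unit_seq_def)
    next
      case 2
      \<comment> \<open>By the parity of \<open>d i\<close> the sample point is 0 or -pi, both
        inside the support; earlier columns fall at -2 pi or below.\<close>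
      have "2 * j - d i = 0 \<or> 2 * j - d i = -1" using 2(2) by presburger
      then have "\<bar>real_of_int (2 * j - d i)\<bar> \<le> 1" by linarith
      then have "M \<xi> i j \<noteq> 0"
        using ent[OF 2(1), of j] theta_pi_pos[of "of_int (2 * j - d i)"] by simp
      moreover have "M \<xi> i h = 0" if "h < j" for h
      proof -
        have "2 * h - d i \<le> -2" using that 2(2) by presburger
        then have "3/2 \<le> \<bar>real_of_int (2 * h - d i)\<bar>" by linarith
        then show ?thesis
          using ent[OF 2(1), of h] theta_pi_zero by simp
      qed
      ultimately show ?thesis using row[OF 2(1)] by blast
    qed
  qed (use finT in simp)
  finally show ?thesis by blast
qed

end

theorem theorem3p1:
  fixes \<epsilon> :: real and \<theta> :: "real \<Rightarrow> real" and r :: nat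
    and k :: "nat \<Rightarrow> int" and \<phi> :: "nat \<Rightarrow> real \<Rightarrow> complex"
  assumes eps: "0 < \<epsilon>" "\<epsilon> < 1/4"
    and theta_smooth: "compactly_supported_smooth \<theta>"
    and theta_nonneg: "\<forall>x. 0 \<le> \<theta> x"
    and theta_pos: "\<forall>x\<in>{-pi-\<epsilon><..<pi+\<epsilon>}. 0 < \<theta> x"
    and theta_supp: "supp \<theta> = {-pi-\<epsilon>..pi+\<epsilon>}"
    and r: "2 \<le> r"
    and phi_integrable: "\<forall>i\<in>{1..r}. integrable lebesgue (\<phi> i)"
    and phi_hat: "\<forall>i\<in>{1..r}. \<forall>\<xi>. fourier (\<phi> i) \<xi> = of_real (\<theta> (\<xi> + of_int (k i) * pi))"
  shows "(\<bar>k 2 - k 1\<bar> = 2 \<and> (\<forall>i\<in>{1..r}. \<forall>j\<in>{1..r}. i \<noteq> j \<longrightarrow> 2 \<le> \<bar>k i - k j\<bar>)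
           \<longrightarrow> (\<lambda>\<xi>. rank_inf r (fourier_matrix \<phi> \<xi>)) constant_on UNIV
               \<and> (\<forall>\<xi>. rank_inf r (fourier_matrix \<phi> \<xi>) = r))
       \<and> (\<bar>k 2 - k 1\<bar> = 2 \<and> (\<exists>i\<^sub>1\<in>{1..r}. \<exists>i\<^sub>2\<in>{1..r}. \<bar>k i\<^sub>1 - k i\<^sub>2\<bar> = 1)
           \<longrightarrow> \<not> (\<lambda>\<xi>. rank_inf r (fourier_matrix \<phi> \<xi>)) constant_on UNIV)"
proof -
  interpret bump_rows \<epsilon> \<theta> r k "fourier_matrix \<phi>"
  proof
    show "\<theta> x = 0" if "x \<le> - pi - \<epsilon> \<or> pi + \<epsilon> \<le> x" for x
      using eq_zero_outside_supp_interval[OF theta_smooth theta_supp] that by blast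
  qed (use eps theta_pos phi_hat in \<open>auto simp: fourier_matrix_def\<close>)
  show ?thesis
  proof (intro conjI impI)
    assume gaps: "\<bar>k 2 - k 1\<bar> = 2 \<and> (\<forall>i\<in>{1..r}. \<forall>j\<in>{1..r}. i \<noteq> j \<longrightarrow> 2 \<le> \<bar>k i - k j\<bar>)"
    then have "rank_inf r (fourier_matrix \<phi> \<xi>) = r" for \<xi>
      by (intro rank_eq_if_gaps) blast
    then show "(\<lambda>\<xi>. rank_inf r (fourier_matrix \<phi> \<xi>)) constant_on UNIV"
      "\<forall>\<xi>. rank_inf r (fourier_matrix \<phi> \<xi>) = r"
      by (auto simp: constant_on_def)
  next
    assume "\<bar>k 2 - k 1\<bar> = 2 \<and> (\<exists>i\<^sub>1\<in>{1..r}. \<exists>i\<^sub>2\<in>{1..r}. \<bar>k i\<^sub>1 - k i\<^sub>2\<bar> = 1)"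
    then obtain a b where "a \<in> {1..r}" "b \<in> {1..r}" "\<bar>k a - k b\<bar> = 1" by blast
    moreover from this have "k a - k b = 1 \<or> k b - k a = 1" by linarith
    ultimately obtain \<xi> \<xi>' where "rank_inf r (fourier_matrix \<phi> \<xi>) < rank_inf r (fourier_matrix \<phi> \<xi>')"
      using rank_less_if_adjacent by blast
    then show "\<not> (\<lambda>\<xi>. rank_inf r (fourier_matrix \<phi> \<xi>)) constant_on UNIV"
      unfolding constant_on_def by (metis UNIV_I less_irrefl)
  qed
qed

end
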